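(* Let $\|\cdot\|$ be a smooth and strictly convex norm on $\mathbb{R}^n$, and let $K\subseteq\mathbb{R}^n$ be a convex body (not necessarily smooth or strictly convex). Then the distance function $d_K:\mathbb{R}^n\to\mathbb{R}$, $d_K(x)=\inf\{\|x-y\|:y\in K\}$, is differentiable in $\mathbb{R}^n\setminus K$. Moreover, its norm gradient satisfies $$\nabla d_K(x)=\eta_K(x)$$ for every $x\in\mathbb{R}^n\setminus K$.
   Context: A convex body is a compact convex set with non-empty interior. A hyperplane $\mathbf{h}$ supports a closed convex set $C$ at $x\in\partial C$ if $C$ is contained in one of the closed half-spaces determined by the translate of $\mathbf{h}$ through $x$. A norm is smooth if its unit ball $B=\{x:\|x\|\le 1\}$ has a unique supporting hyperplane at each boundary point, and strictly convex if $\partial B$ contains no (non-degenerate) line segment. Birkhoff orthogonality: $x\dashv_B y$ means $\|x+ty\|\ge\|x\|$ for all $t\in\mathbb{R}$; for a hyperplane $\mathbf{h}$ (taken through the origin), $x\dashv_B\mathbf{h}$ ($x$ is Birkhoff left-orthogonal to $\mathbf{h}$) means $x\dashv_B z$ for all $z\in\mathbf{h}$. For $x\in\mathbb{R}^n$, $p_K(x)$ denotes the metric projection of $x$ onto $K$, i.e. the (here unique) point of $K$ with $\|x-p_K(x)\|=d_K(x)$. For $x\notin K$, $\eta_K(x):=\dfrac{x-p_K(x)}{\|x-p_K(x)\|}$. Norm gradient: let $f:\mathbb{R}^n\to\mathbb{R}$ be convex and (Fréchet) differentiable at $x$, and put $c=f(x)$. If $c$ is not the global minimum of $f$, then $\nabla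 f(x)$ is the unique non-zero vector such that (a) $\nabla f(x)$ is Birkhoff left-orthogonal to the (unique) supporting hyperplane of the sub-level set $\{f\le c\}$ at $x$, and (b) $df_x(\nabla f(x))=\|\nabla f(x)\|^2$. If $c$ is the global minimum, $\nabla f(x)=0$. (The function $d_K$ is convex.) *)

theory Defs
  imports "HOL-Analysis.Analysis"
begin

text \<open>
  The norm of the type class on \<^typ>\<open>real ^ 'n\<close> is the Euclidean one, so an arbitrary norm is
  carried as a function \<open>N\<close>. Topological notions and differentiability refer to the Euclidean
  structure; in finite dimension they do not depend on the choice of norm.
\<close>

definition is_norm :: "('a::real_vector \<Rightarrow> real) \<Rightarrow> bool" where
  "is_norm N \<longleftrightarrow>
     (\<forall>x. 0 \<le> N x) \<and> (\<forall>x. N x = 0 \<longleftrightarrow> x = 0) \<and>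
     (\<forall>c x. N (c *\<^sub>R x) = \<bar>c\<bar> * N x) \<and>
     (\<forall>x y. N (x + y) \<le> N x + N y)"

definition unit_ball :: "('a::real_vector \<Rightarrow> real) \<Rightarrow> 'a set" where
  "unit_ball N = {x. N x \<le> 1}"

definition convex_body :: "'a::euclidean_space set \<Rightarrow> bool" where
  "convex_body K \<longleftrightarrow> compact K \<and> convex K \<and> interior K \<noteq> {}"

text \<open>
  A hyperplane \<open>h\<close> is a linear one, \<open>{z. a \<bullet> z = 0}\<close>; it is its translate through \<open>x\<close> that touches
  \<open>C\<close>. Uniqueness of supporting hyperplanes is uniqueness of the set \<open>h\<close>, not of the normal \<open>a\<close>.
\<close>

definition supports_at :: "'a::euclidean_space set \<Rightarrow> 'a set \<Rightarrow> 'a \<Rightarrow> bool" where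
  "supports_at h C x \<longleftrightarrow> x \<in> frontier C \<and>
     (\<exists>a. a \<noteq> 0 \<and> h = {z. a \<bullet> z = 0} \<and>
        (C \<subseteq> {z. a \<bullet> z \<le> a \<bullet> x} \<or> C \<subseteq> {z. a \<bullet> z \<ge> a \<bullet> x}))"

definition smooth_norm :: "('a::euclidean_space \<Rightarrow> real) \<Rightarrow> bool" where
  "smooth_norm N \<longleftrightarrow> (\<forall>x \<in> frontier (unit_ball N). \<exists>!h. supports_at h (unit_ball N) x)"

definition strictly_convex_norm :: "('a::euclidean_space \<Rightarrow> real) \<Rightarrow> bool" where
  "strictly_convex_norm N \<longleftrightarrow>
     \<not> (\<exists>x y. x \<noteq> y \<and> closed_segment x y \<subseteq> frontier (unit_ball N))"

definition birkhoff_orth :: "('a::real_vector \<Rightarrow> real) \<Rightarrow> 'a \<Rightarrow> 'a \<Rightarrow> bool" where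
  "birkhoff_orth N x y \<longleftrightarrow> (\<forall>t. N (x + t *\<^sub>R y) \<ge> N x)"

definition birkhoff_left_orth :: "('a::real_vector \<Rightarrow> real) \<Rightarrow> 'a \<Rightarrow> 'a set \<Rightarrow> bool" where
  "birkhoff_left_orth N x h \<longleftrightarrow> (\<forall>z\<in>h. birkhoff_orth N x z)"

definition norm_dist :: "('a::real_vector \<Rightarrow> real) \<Rightarrow> 'a set \<Rightarrow> 'a \<Rightarrow> real" where
  "norm_dist N K x = (INF y\<in>K. N (x - y))"

definition metric_projection :: "('a::real_vector \<Rightarrow> real) \<Rightarrow> 'a set \<Rightarrow> 'a \<Rightarrow> 'a" where
  "metric_projection N K x = (THE p. p \<in> K \<and> N (x - p) = norm_dist N K x)"

definition unit_outward :: "('a::real_vector \<Rightarrow> real) \<Rightarrow> 'a set \<Rightarrow> 'a \<Rightarrow> 'a" where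
  "unit_outward N K x =
     (1 / N (x - metric_projection N K x)) *\<^sub>R (x - metric_projection N K x)"

text \<open>
  The two conditions singling out the gradient when \<open>f x\<close> is not the minimum of \<open>f\<close>; \<open>D\<close> is the
  differential of \<open>f\<close> at \<open>x\<close>. The equivalence says that \<open>h\<close> is the one and only supporting
  hyperplane of the sub-level set at \<open>x\<close>.
\<close>

definition gradient_conditions ::
  "('a::euclidean_space \<Rightarrow> real) \<Rightarrow> ('a \<Rightarrow> real) \<Rightarrow> 'a \<Rightarrow> ('a \<Rightarrow> real) \<Rightarrow> 'a \<Rightarrow> bool" where
  "gradient_conditions N f x D v \<longleftrightarrow>
     (\<exists>h. (\<forall>h'. supports_at h' {y. f y \<le> f x} x \<longleftrightarrow> h' = h) \<and> birkhoff_left_orth N v h) \<and>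
     D v = (N v)\<^sup>2"

text \<open>
  \<open>has_norm_gradient N f x v\<close>: the function \<open>f\<close> is convex and differentiable at \<open>x\<close>, and its norm
  gradient at \<open>x\<close> exists and equals \<open>v\<close>. Being the unique non-zero vector satisfying the
  conditions is part of the predicate, so at most one \<open>v\<close> is related to given \<open>N\<close>, \<open>f\<close>, \<open>x\<close>.
\<close>

definition has_norm_gradient ::
  "('a::euclidean_space \<Rightarrow> real) \<Rightarrow> ('a \<Rightarrow> real) \<Rightarrow> 'a \<Rightarrow> 'a \<Rightarrow> bool" where
  "has_norm_gradient N f x v \<longleftrightarrow>
     convex_on UNIV f \<and>
     (\<exists>D. (f has_derivative D) (at x) \<and>
        (if \<forall>y. f x \<le> f y then v = 0
         else \<forall>w. w \<noteq> 0 \<and> gradient_conditions N f x D w \<longleftrightarrow> w = v))"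

lemma has_norm_gradient_unique:
  assumes "has_norm_gradient N f x v" "has_norm_gradient N f x w"
  shows "v = w"
proof -
  obtain D E where D: "(f has_derivative D) (at x)"
      "if \<forall>y. f x \<le> f y then v = 0
       else \<forall>u. u \<noteq> 0 \<and> gradient_conditions N f x D u \<longleftrightarrow> u = v"
    and E: "(f has_derivative E) (at x)"
      "if \<forall>y. f x \<le> f y then w = 0
       else \<forall>u. u \<noteq> 0 \<and> gradient_conditions N f x E u \<longleftrightarrow> u = w"
    using assms unfolding has_norm_gradient_def by blast
  have "D = E" using D(1) E(1) by (rule has_derivative_unique)
  with D(2) E(2) show ?thesis by (metis (full_types))
qed

definition norm_gradient ::
  "('a::euclidean_space \<Rightarrow> real) \<Rightarrow> ('a \<Rightarrow> real) \<Rightarrow> 'a \<Rightarrow> 'a" where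
  "norm_gradient N f x = (THE v. has_norm_gradient N f x v)"

lemma norm_gradient_eq: "has_norm_gradient N f x v \<Longrightarrow> norm_gradient N f x = v"
  unfolding norm_gradient_def by (blast intro: has_norm_gradient_unique)

end

theory Submission imports Defs
begin

text \<open>
  Let \<open>p\<close> be the projection of \<open>x\<close> onto \<open>K\<close>. The convex function \<open>d\<^sub>K\<close> lies below \<open>z \<mapsto> N (z - p)\<close>,
  with equality at \<open>x\<close>, and a convex function touched from above by a differentiable one is
  differentiable with the same derivative. That \<open>N\<close> is differentiable away from the origin
  follows from smoothness: the norming functional at a point is unique, hence by compactness
  depends continuously on the point. The ball of radius \<open>d\<^sub>K x\<close> around \<open>p\<close> lies in the sub-level
  set \<open>{d\<^sub>K \<le> d\<^sub>K x}\<close>, so every supporting hyperplane of the latter at \<open>x\<close> is the kernel of the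
  norming functional of \<open>x - p\<close>; strict convexity leaves only one vector orthogonal to it with
  the required length.
\<close>

subsection \<open>Norms and norming functionals\<close>

lemma is_normD:
  assumes "is_norm N"
  shows "0 \<le> N x" "N x = 0 \<longleftrightarrow> x = 0" "N (c *\<^sub>R x) = \<bar>c\<bar> * N x" "N (x + y) \<le> N x + N y"
  using assms unfolding is_norm_def by auto

lemma is_norm_pos: "is_norm N \<Longrightarrow> x \<noteq> 0 \<Longrightarrow> 0 < N x"
  using is_normD(1,2) by (metis less_eq_real_def)

lemma is_norm_convex_comb:
  assumes "is_norm N" "0 \<le> u" "0 \<le> v"
  shows "N (u *\<^sub>R x + v *\<^sub>R y) \<le> u * N x + v * N y"
  using is_normD(4)[OF assms(1), of "u *\<^sub>R x" "v *\<^sub>R y"] assms(2,3)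
  by (simp add: is_normD(3)[OF assms(1)])

lemma is_norm_convex_on: "is_norm N \<Longrightarrow> convex_on UNIV N"
  by (simp add: convex_on_def is_norm_convex_comb)

lemma is_norm_continuous_on:
  fixes N :: "'a::euclidean_space \<Rightarrow> real"
  shows "is_norm N \<Longrightarrow> continuous_on S N"
  by (meson continuous_on_subset convex_on_continuous is_norm_convex_on open_UNIV subset_UNIV)

lemma is_norm_bound:
  fixes N :: "'a::euclidean_space \<Rightarrow> real"
  assumes N: "is_norm N"
  obtains C where "C > 0" "\<And>x. N x \<le> C * norm x"
proof -
  have "compact (N ` sphere 0 1)"
    by (intro compact_continuous_image is_norm_continuous_on[OF N] compact_sphere)
  then obtain C where "C > 0" "\<forall>y\<in>N ` sphere 0 1. norm y \<le> C"
    using compact_imp_bounded bounded_pos by blast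
  then have C: "C > 0" "\<And>x. norm x = 1 \<Longrightarrow> N x \<le> C"
    by (auto simp: is_normD(1)[OF N])
  have "N x \<le> C * norm x" for x
  proof (cases "x = 0")
    case False
    then have "N ((1 / norm x) *\<^sub>R x) \<le> C" by (intro C) simp
    then show ?thesis using False by (simp add: is_normD(3)[OF N] field_simps)
  qed (use is_normD(2)[OF N, of 0] in simp)
  with C that show ?thesis by blast
qed

text \<open>Scaling a vector of norm 1 by any factor above 1 leaves the ball, so no Euclidean
  neighbourhood of it is contained in the ball.\<close>

lemma norm_eq_1_in_frontier:
  fixes N :: "'a::euclidean_space \<Rightarrow> real"
  assumes N: "is_norm N" and x: "N x = 1"
  shows "x \<in> frontier (unit_ball N)"
proof -
  have "x \<notin> interior (unit_ball N)"
  proof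
    assume "x \<in> interior (unit_ball N)"
    then obtain e where e: "e > 0" "cball x e \<subseteq> unit_ball N"
      by (auto simp: mem_interior_cball)
    have x0: "x \<noteq> 0" using x is_normD(2)[OF N, of x] by auto
    have "(1 + e / norm x) *\<^sub>R x \<in> cball x e"
      using e x0 by (simp add: dist_norm scaleR_left_distrib)
    then have "\<bar>1 + e / norm x\<bar> \<le> 1"
      using e(2) x is_normD(3)[OF N] by (force simp: unit_ball_def)
    moreover have "e / norm x > 0" using e x0 by simp
    ultimately show False by linarith
  qed
  moreover have "x \<in> closure (unit_ball N)"
    using x closure_subset[of "unit_ball N"] by (auto simp: unit_ball_def)
  ultimately show ?thesis by (simp add: frontier_def)
qed

section \<open>Functionals attaining the norm\<close>

text \<open>These are the subgradients of \<open>N\<close> at \<open>y\<close>, with functionals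
  represented by vectors through the Euclidean inner product. For nonzero \<open>y\<close> they have
  dual norm 1.\<close>

definition norming :: "('a::euclidean_space \<Rightarrow> real) \<Rightarrow> 'a \<Rightarrow> 'a \<Rightarrow> bool" where
  "norming N a y \<longleftrightarrow> (\<forall>z. a \<bullet> z \<le> N z) \<and> a \<bullet> y = N y"

text \<open>A finite-dimensional Hahn-Banach argument: separate the open ball of radius
  \<open>N y\<close> from its boundary point \<open>y\<close>, then rescale the normal so that its
  value at \<open>y\<close> is \<open>N y\<close>.\<close>

lemma norming_exists:
  assumes N: "is_norm N"
  shows "\<exists>a. norming N a y"
proof (cases "y = 0")
  case True
  then show ?thesis
    using is_normD(1,2)[OF N] by (intro exI[of _ 0]) (auto simp: norming_def)
next
  case False
  define S where "S = {z. N z < N y}"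
  have Ny: "N y > 0" by (rule is_norm_pos[OF N False])
  have "convex S"
    unfolding convex_def S_def
    using is_norm_convex_comb[OF N] convex_bound_lt by (blast intro: order_le_less_trans)
  moreover have "0 \<in> S" using Ny is_normD(2)[OF N, of 0] by (simp add: S_def)
  moreover have "y \<notin> S" by (simp add: S_def)
  ultimately obtain a b where a: "a \<noteq> 0" and S: "\<And>z. z \<in> S \<Longrightarrow> a \<bullet> z \<le> b" and yb: "a \<bullet> y \<ge> b"
    using separating_hyperplane_sets[of S "{y}"] by auto
  \<comment> \<open>This \<open>t\<close> gives \<open>t *\<^sub>R a\<close> norm
    \<open>N y / 2\<close>, hence a point of \<open>S\<close> on which \<open>a\<close> is positive.
    Separation then makes \<open>a\<close> positive at \<open>y\<close>, so the rescaling below is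
    legitimate.\<close>
  define t where "t = N y / (2 * N a)"
  have Na: "N a > 0" by (rule is_norm_pos[OF N a])
  have "t > 0" using Na Ny by (simp add: t_def)
  then have "t * (a \<bullet> a) > 0" using a by simp
  moreover have "t *\<^sub>R a \<in> S"
    using Na Ny by (simp add: S_def t_def is_normD(3)[OF N])
  ultimately have ay: "a \<bullet> y > 0"
    using S[of "t *\<^sub>R a"] yb unfolding inner_scaleR_right by linarith
  define c where "c = (N y / (a \<bullet> y)) *\<^sub>R a"
  have "c \<bullet> z \<le> N z" for z
  proof (cases "z = 0")
    case z: False
    then have Nz: "N z > 0" by (rule is_norm_pos[OF N])
    \<comment> \<open>Since \<open>S\<close> is the open ball, \<open>z\<close> is first scaled to
      norm \<open>s * N y\<close> with \<open>s < 1\<close>; the bound for \<open>c\<close> follows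
      as \<open>s\<close> tends to 1.\<close>
    have le: "s * (c \<bullet> z) \<le> N z" if s: "0 < s" "s < 1" for s
    proof -
      have "(s * N y / N z) *\<^sub>R z \<in> S"
        using s Ny Nz by (simp add: S_def is_normD(3)[OF N])
      then have "s * N y / N z * (a \<bullet> z) \<le> a \<bullet> y" using S yb by fastforce
      then show ?thesis using Nz ay by (simp add: c_def field_simps)
    qed
    show ?thesis
      using field_le_mult_one_interval[of "c \<bullet> z" "N z"] le by blast
  qed (simp add: is_normD(1)[OF N])
  moreover have "c \<bullet> y = N y" using ay by (simp add: c_def)
  ultimately show ?thesis by (auto simp: norming_def)
qed

text \<open>This is the passage from functionals to the geometric definition of smoothness:
  \<open>a\<close> is at most 1 on the unit ball and equals 1 at the normalised
  \<open>y\<close>.\<close>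

lemma norming_supports:
  assumes N: "is_norm N" and y: "y \<noteq> 0" and a: "norming N a y"
  shows "supports_at {z. a \<bullet> z = 0} (unit_ball N) ((1 / N y) *\<^sub>R y)"
proof -
  have Ny: "N y > 0" by (rule is_norm_pos[OF N y])
  have "a \<bullet> ((1 / N y) *\<^sub>R y) = 1" "a \<noteq> 0" using a Ny by (auto simp: norming_def)
  moreover have "\<And>z. N z \<le> 1 \<Longrightarrow> a \<bullet> z \<le> 1" using a by (auto simp: norming_def intro: order_trans)
  moreover have "(1 / N y) *\<^sub>R y \<in> frontier (unit_ball N)"
    using Ny by (intro norm_eq_1_in_frontier[OF N]) (simp add: is_normD(3)[OF N])
  ultimately show ?thesis
    unfolding supports_at_def by (auto simp: unit_ball_def intro!: exI[of _ a])
qed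

lemma smooth_norm_unique_support:
  assumes N: "is_norm N" "smooth_norm N" and y: "y \<noteq> 0" and a: "norming N a y"
    and h: "supports_at h (unit_ball N) ((1 / N y) *\<^sub>R y)"
  shows "h = {z. a \<bullet> z = 0}"
  using N(2) h norming_supports[OF N(1) y a] unfolding smooth_norm_def supports_at_def by blast

text \<open>Smoothness forces the two kernels to coincide. A functional is determined by its kernel
  together with its value at one point outside it, here \<open>N y\<close> at
  \<open>y\<close>.\<close>

lemma norming_unique:
  assumes N: "is_norm N" "smooth_norm N" and y: "y \<noteq> 0"
    and a: "norming N a y" and b: "norming N b y"
  shows "a = b"
proof -
  have ker: "{z. a \<bullet> z = 0} = {z. b \<bullet> z = 0}"
    by (rule smooth_norm_unique_support[OF N y b norming_supports[OF N(1) y a]])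
  have Ny: "N y > 0" by (rule is_norm_pos[OF N(1) y])
  have "a \<bullet> z = b \<bullet> z" for z
  proof -
    \<comment> \<open>The projection of \<open>z\<close> along \<open>y\<close> onto the common
      kernel.\<close>
    have "z - ((a \<bullet> z) / N y) *\<^sub>R y \<in> {z. a \<bullet> z = 0}"
      using a Ny by (simp add: norming_def inner_diff_right)
    then have "b \<bullet> (z - ((a \<bullet> z) / N y) *\<^sub>R y) = 0" using ker by blast
    then show ?thesis using b Ny by (simp add: norming_def inner_diff_right)
  qed
  then show ?thesis by (metis vector_eq_ldot inner_commute)
qed

section \<open>Differentiability of a smooth norm away from the origin\<close>

text \<open>Here \<open>b\<close> is an arbitrary selection of norming functionals. All its values
  lie in one Euclidean ball, and the norming relation is closed under limits. Hence a sequence of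
  values staying away from \<open>a\<close> would have a limit point norming \<open>x\<close> and
  different from \<open>a\<close>, against uniqueness.\<close>

lemma norming_continuous:
  fixes N :: "'a::euclidean_space \<Rightarrow> real"
  assumes N: "is_norm N" "smooth_norm N" and x: "x \<noteq> 0" and a: "norming N a x"
    and b: "\<And>y. norming N (b y) y"
  shows "(b \<longlongrightarrow> a) (at x)"
proof -
  obtain C where C: "\<And>z. N z \<le> C * norm z" using is_norm_bound[OF N(1)] by blast
  have bdd: "norm (b y) \<le> C" for y
  proof (cases "b y = 0")
    case True
    have "0 \<le> C" using is_normD(1)[OF N(1), of x] C[of x] x
      by (smt (verit) mult_neg_pos zero_less_norm_iff)
    then show ?thesis using True by simp
  next
    case False
    \<comment> \<open>The inequality for \<open>b y\<close> is tested on the vector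
      \<open>b y\<close> itself.\<close>
    have "norm (b y) * norm (b y) \<le> C * norm (b y)"
      using b[of y] C[of "b y"] unfolding norming_def
      by (metis dot_square_norm order_trans power2_eq_square)
    then show ?thesis using False by simp
  qed
  have contN: "isCont N x"
    using is_norm_continuous_on[OF N(1), of UNIV] by (simp add: continuous_on_eq_continuous_at)
  show ?thesis
  proof (rule ccontr)
    assume "\<not> ?thesis"
    then obtain e where e: "e > 0" and "\<not> eventually (\<lambda>y. dist (b y) a < e) (at x)"
      by (auto simp: tendsto_iff)
    then have "\<exists>y. dist y x < inverse (real (Suc n)) \<and> dist (b y) a \<ge> e" for n
      unfolding eventually_at using e by (metis inverse_positive_iff_positive not_less of_nat_0_less_iff zero_less_Suc)
    then obtain Y where Y: "\<And>n. dist (Y n) x < inverse (real (Suc n))" "\<And>n. dist (b (Y n)) a \<ge> e"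
      by metis
    have Yx: "Y \<longlonglongrightarrow> x"
      unfolding tendsto_dist_iff[of Y]
      by (rule tendsto_sandwich[OF _ _ tendsto_const LIMSEQ_inverse_real_of_nat])
         (auto intro!: always_eventually less_imp_le Y(1)[simplified])
    have "\<forall>n. (b \<circ> Y) n \<in> cball 0 C" using bdd by simp
    then obtain l r where r: "strict_mono r" and "((b \<circ> Y) \<circ> r) \<longlonglongrightarrow> l"
      using compact_cball[of "0::'a" C] unfolding compact_def by blast
    then have l: "(\<lambda>n. b (Y (r n))) \<longlonglongrightarrow> l" by (simp add: comp_def)
    have Yr: "(\<lambda>n. Y (r n)) \<longlonglongrightarrow> x"
      using LIMSEQ_subseq_LIMSEQ[OF Yx r] by (simp add: comp_def)
    have "l \<bullet> z \<le> N z" for z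
      by (rule tendsto_upperbound[OF tendsto_inner[OF l tendsto_const]])
         (use b in \<open>auto simp: norming_def\<close>)
    moreover have "l \<bullet> x = N x"
    proof (rule LIMSEQ_unique)
      show "(\<lambda>n. b (Y (r n)) \<bullet> Y (r n)) \<longlonglongrightarrow> l \<bullet> x" by (intro tendsto_intros l Yr)
      show "(\<lambda>n. b (Y (r n)) \<bullet> Y (r n)) \<longlonglongrightarrow> N x"
        using isCont_tendsto_compose[OF contN Yr] b by (simp add: norming_def)
    qed
    ultimately have "norming N l x" by (simp add: norming_def)
    then have "l = a" by (rule norming_unique[OF N x _ a])
    then have "(\<lambda>n. dist (b (Y (r n))) a) \<longlonglongrightarrow> 0" using l tendsto_dist_iff[THEN iffD1] by simp
    then have "0 \<ge> e" by (rule tendsto_lowerbound) (use Y(2) in auto)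
    with e show False by simp
  qed
qed

text \<open>The subgradient inequalities at \<open>x\<close> and at \<open>y\<close> squeeze
  \<open>N y - N x\<close> between \<open>a \<bullet> (y - x)\<close> and
  \<open>b y \<bullet> (y - x)\<close>. By Cauchy-Schwarz and the continuity of \<open>b\<close> at
  \<open>x\<close>, the gap is at most \<open>e * norm (y - x)\<close>.\<close>

lemma norm_has_derivative_norming:
  fixes N :: "'a::euclidean_space \<Rightarrow> real"
  assumes N: "is_norm N" "smooth_norm N" and x: "x \<noteq> 0" and a: "norming N a x"
  shows "(N has_derivative (\<bullet>) a) (at x)"
  unfolding has_derivative_at_alt
proof (intro conjI allI impI)
  show "bounded_linear ((\<bullet>) a)" by (rule bounded_linear_inner_right)
  fix e :: real assume e: "e > 0"
  obtain b where b: "\<And>y. norming N (b y) y" using norming_exists[OF N(1)] by metis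
  have "eventually (\<lambda>y. dist (b y) a < e) (at x)"
    using norming_continuous[OF N x a b] e by (rule tendstoD)
  then obtain d where d: "d > 0" "\<And>y. y \<noteq> x \<Longrightarrow> dist y x < d \<Longrightarrow> dist (b y) a < e"
    by (auto simp: eventually_at)
  have "norm (N y - N x - a \<bullet> (y - x)) \<le> e * norm (y - x)" if y: "norm (y - x) < d" for y
  proof (cases "y = x")
    case False
    have "(b y - a) \<bullet> (y - x) \<le> norm (b y - a) * norm (y - x)" by (rule norm_cauchy_schwarz)
    also have "\<dots> \<le> e * norm (y - x)"
      using d(2)[OF False] y by (intro mult_right_mono) (auto simp: dist_norm)
    finally have "b y \<bullet> (y - x) - a \<bullet> (y - x) \<le> e * norm (y - x)" by (simp add: inner_diff_left)
    moreover have "N y - N x \<le> b y \<bullet> (y - x)" "a \<bullet> (y - x) \<le> N y - N x"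
      using a b[of y] by (auto simp: norming_def inner_diff_right)
    ultimately show ?thesis by simp
  qed simp
  with d show "\<exists>d>0. \<forall>y. norm (y - x) < d \<longrightarrow> norm (N y - N x - a \<bullet> (y - x)) \<le> e * norm (y - x)"
    by blast
qed

subsection \<open>Differentiability of convex functions\<close>

text \<open>The upper estimate for \<open>f y\<close> is that of \<open>g y\<close>. The lower one
  comes from the reflection \<open>z\<close> of \<open>y\<close> in \<open>x\<close>: midpoint
  convexity gives \<open>f y \<ge> 2 * f x - f z\<close>, and \<open>f z\<close> is bounded above by
  \<open>g z\<close>.\<close>

lemma convex_has_derivative_touching:
  fixes f g :: "'a::real_normed_vector \<Rightarrow> real"
  assumes f: "convex_on UNIV f" and le: "\<And>y. f y \<le> g y" and eq: "f x = g x"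
    and g: "(g has_derivative D) (at x)"
  shows "(f has_derivative D) (at x)"
  unfolding has_derivative_at_alt
proof (intro conjI allI impI)
  show lin: "bounded_linear D" using g by (rule has_derivative_bounded_linear)
  fix e :: real assume "e > 0"
  then obtain d where d: "d > 0"
    "\<And>y. norm (y - x) < d \<Longrightarrow> norm (g y - g x - D (y - x)) \<le> e * norm (y - x)"
    using g unfolding has_derivative_at_alt by blast
  have "norm (f y - f x - D (y - x)) \<le> e * norm (y - x)" if y: "norm (y - x) < d" for y
  proof -
    define z where "z = 2 *\<^sub>R x - y"
    have zx: "z - x = - (y - x)" by (simp add: z_def scaleR_2)
    have "f ((1/2) *\<^sub>R y + (1/2) *\<^sub>R z) \<le> (1/2) * f y + (1/2) * f z"
      using f unfolding convex_on_def by (metis UNIV_I field_sum_of_halves half_gt_zero_iff less_eq_real_def zero_less_one)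
    moreover have "(1/2) *\<^sub>R y + (1/2) *\<^sub>R z = x" by (simp add: z_def algebra_simps)
    ultimately have mid: "2 * f x \<le> f y + f z" by simp
    have "norm (z - x) = norm (y - x)" "D (z - x) = - D (y - x)"
      using zx norm_minus_cancel linear_neg[OF bounded_linear.linear[OF lin]] by metis+
    then have "\<bar>g y - g x - D (y - x)\<bar> \<le> e * norm (y - x)"
      "\<bar>g z - g x + D (y - x)\<bar> \<le> e * norm (y - x)"
      using d(2)[of y] d(2)[of z] y by simp_all
    then show ?thesis using mid le[of y] le[of z] eq by (simp add: abs_le_iff)
  qed
  with d show "\<exists>d>0. \<forall>y. norm (y - x) < d \<longrightarrow> norm (f y - f x - D (y - x)) \<le> e * norm (y - x)"
    by blast
qed

lemma convex_above_derivative: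
  fixes f :: "'a::real_normed_vector \<Rightarrow> real"
  assumes f: "convex_on UNIV f" and D: "(f has_derivative D) (at x)"
  shows "f x + D (y - x) \<le> f y"
proof (cases "y = x")
  case True
  then show ?thesis using linear_0[OF has_derivative_linear[OF D]] by simp
next
  case False
  show ?thesis
  proof (rule field_le_epsilon)
    fix e :: real assume "e > 0"
    \<comment> \<open>With this tolerance the linearisation error at a point a fraction
      \<open>t\<close> of the way from \<open>x\<close> to \<open>y\<close> is at most
      \<open>t * e\<close>, so that dividing by \<open>t\<close> leaves exactly
      \<open>e\<close>.\<close>
    define k where "k = e / norm (y - x)"
    have k: "k > 0" using \<open>e > 0\<close> False by (simp add: k_def)
    then obtain d where d: "d > 0"
      "\<And>z. norm (z - x) < d \<Longrightarrow> norm (f z - f x - D (z - x)) \<le> k * norm (z - x)"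
      using D unfolding has_derivative_at_alt by blast
    \<comment> \<open>The factor 2 keeps \<open>z\<close> strictly within distance \<open>d\<close>
      of \<open>x\<close>; the cap 1 keeps it on the segment, where convexity applies.\<close>
    define t where "t = min 1 (d / (2 * norm (y - x)))"
    have t: "0 < t" "t \<le> 1" using d False by (auto simp: t_def)
    define z where "z = x + t *\<^sub>R (y - x)"
    have "t * norm (y - x) \<le> d / (2 * norm (y - x)) * norm (y - x)"
      by (intro mult_right_mono) (auto simp: t_def)
    also have "\<dots> < d" using False d(1) by simp
    finally have "\<bar>f z - f x - D (z - x)\<bar> \<le> k * norm (z - x)"
      using d(2)[of z] t by (simp add: z_def)
    moreover have "D (z - x) = t * D (y - x)"
      using linear_scale[OF has_derivative_linear[OF D]] by (simp add: z_def)
    moreover have "k * norm (z - x) = t * e" using t False by (simp add: z_def k_def)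
    moreover have "f z \<le> (1 - t) * f x + t * f y"
    proof -
      have "z = (1 - t) *\<^sub>R x + t *\<^sub>R y" by (simp add: z_def algebra_simps)
      then show ?thesis using convex_onD[OF f, of t x y] t by simp
    qed
    ultimately have "t * (f x + D (y - x)) \<le> t * (f y + e)" by (simp add: algebra_simps)
    then show "f x + D (y - x) \<le> f y + e" using t by simp
  qed
qed

subsection \<open>The distance function\<close>

lemma norm_dist_le:
  assumes "is_norm N" "y \<in> K"
  shows "norm_dist N K x \<le> N (x - y)"
  unfolding norm_dist_def
  by (rule cINF_lower[OF _ assms(2)]) (use is_normD(1)[OF assms(1)] in \<open>auto intro!: bdd_belowI[of _ 0]\<close>)

lemma norm_dist_attained:
  fixes N :: "'a::euclidean_space \<Rightarrow> real"
  assumes N: "is_norm N" and K: "compact K" "K \<noteq> {}"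
  obtains p where "p \<in> K" "N (x - p) = norm_dist N K x"
proof -
  have "continuous_on K (N \<circ> (\<lambda>y. x - y))"
    by (intro continuous_on_compose continuous_intros is_norm_continuous_on[OF N])
  from continuous_attains_inf[OF K this]
  obtain p where p: "p \<in> K" "\<And>y. y \<in> K \<Longrightarrow> N (x - p) \<le> N (x - y)"
    by auto
  have "N (x - p) = norm_dist N K x"
    unfolding norm_dist_def
    by (rule antisym[OF cINF_greatest[OF K(2) p(2)]]) (use norm_dist_le[OF N p(1)] norm_dist_def in metis)+
  with p that show ?thesis by blast
qed

lemma norm_dist_convex_on:
  fixes N :: "'a::euclidean_space \<Rightarrow> real"
  assumes N: "is_norm N" and K: "compact K" "convex K" "K \<noteq> {}"
  shows "convex_on UNIV (norm_dist N K)"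
  unfolding convex_on_def
proof (intro conjI ballI allI impI convex_UNIV)
  fix x y and u v :: real assume uv: "0 \<le> u" "0 \<le> v" "u + v = 1"
  obtain p where p: "p \<in> K" "N (x - p) = norm_dist N K x" by (rule norm_dist_attained[OF N K(1,3)])
  obtain q where q: "q \<in> K" "N (y - q) = norm_dist N K y" by (rule norm_dist_attained[OF N K(1,3)])
  \<comment> \<open>The same convex combination of the nearest points is the competitor for the
    distance at the combined point.\<close>
  have "u *\<^sub>R p + v *\<^sub>R q \<in> K" using K(2) p q uv by (simp add: convex_def)
  then have "norm_dist N K (u *\<^sub>R x + v *\<^sub>R y) \<le> N (u *\<^sub>R x + v *\<^sub>R y - (u *\<^sub>R p + v *\<^sub>R q))"
    by (rule norm_dist_le[OF N])
  also have "u *\<^sub>R x + v *\<^sub>R y - (u *\<^sub>R p + v *\<^sub>R q) = u *\<^sub>R (x - p) + v *\<^sub>R (y - q)"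
    by (simp add: algebra_simps)
  also have "N \<dots> \<le> u * norm_dist N K x + v * norm_dist N K y"
    using is_norm_convex_comb[OF N uv(1,2)] p q by metis
  finally show "norm_dist N K (u *\<^sub>R x + v *\<^sub>R y) \<le> u * norm_dist N K x + v * norm_dist N K y" .
qed

section \<open>Strict convexity and uniqueness of the nearest point\<close>

text \<open>A segment between unit vectors stays in the ball by convexity; if it also avoids the
  open ball, it lies on the sphere and must be degenerate. In this form it serves both for nearest
  points and for the uniqueness of the gradient.\<close>

lemma strictly_convex_norm_eq:
  fixes N :: "'a::euclidean_space \<Rightarrow> real"
  assumes N: "is_norm N" "strictly_convex_norm N" and xy: "N x = 1" "N y = 1"
    and ge: "\<And>u. 0 \<le> u \<Longrightarrow> u \<le> 1 \<Longrightarrow> 1 \<le> N ((1 - u) *\<^sub>R x + u *\<^sub>R y)"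
  shows "x = y"
proof (rule ccontr)
  assume "x \<noteq> y"
  moreover have "closed_segment x y \<subseteq> frontier (unit_ball N)"
  proof
    fix z assume "z \<in> closed_segment x y"
    then obtain u where u: "0 \<le> u" "u \<le> 1" "z = (1 - u) *\<^sub>R x + u *\<^sub>R y"
      by (auto simp: closed_segment_def)
    then have "N z = 1"
      using is_norm_convex_comb[OF N(1), of "1 - u" u x y] ge[OF u(1,2)] xy by simp
    then show "z \<in> frontier (unit_ball N)" by (rule norm_eq_1_in_frontier[OF N(1)])
  qed
  ultimately show False using N(2) by (auto simp: strictly_convex_norm_def)
qed

text \<open>For two nearest points the segment between them lies in \<open>K\<close>, so none of its
  points is closer to \<open>x\<close> than \<open>r\<close>. Dividing by \<open>r\<close> turns
  this into a segment of unit vectors avoiding the open unit ball.\<close>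

lemma metric_projection_eq:
  fixes N :: "'a::euclidean_space \<Rightarrow> real"
  assumes N: "is_norm N" "strictly_convex_norm N" and K: "convex K" and x: "x \<notin> K"
    and p: "p \<in> K" "N (x - p) = norm_dist N K x"
  shows "metric_projection N K x = p"
  unfolding metric_projection_def
proof (rule the_equality)
  fix q assume q: "q \<in> K \<and> N (x - q) = norm_dist N K x"
  define r where "r = norm_dist N K x"
  have r: "r > 0" using p x is_norm_pos[OF N(1), of "x - p"] by (auto simp: r_def)
  have "(1 / r) *\<^sub>R (x - q) = (1 / r) *\<^sub>R (x - p)"
  proof (rule strictly_convex_norm_eq[OF N])
    fix u :: real assume u: "0 \<le> u" "u \<le> 1"
    have "(1 - u) *\<^sub>R q + u *\<^sub>R p \<in> K" using K p q u by (simp add: convex_alt)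
    then have "r \<le> N (x - ((1 - u) *\<^sub>R q + u *\<^sub>R p))" unfolding r_def by (rule norm_dist_le[OF N(1)])
    moreover have "(1 - u) *\<^sub>R ((1 / r) *\<^sub>R (x - q)) + u *\<^sub>R ((1 / r) *\<^sub>R (x - p))
        = (1 / r) *\<^sub>R (x - ((1 - u) *\<^sub>R q + u *\<^sub>R p))"
      by (simp add: algebra_simps diff_divide_distrib)
    ultimately show "1 \<le> N ((1 - u) *\<^sub>R ((1 / r) *\<^sub>R (x - q)) + u *\<^sub>R ((1 / r) *\<^sub>R (x - p)))"
      using r by (simp add: is_normD(3)[OF N(1)])
  qed (use p q r in \<open>auto simp: is_normD(3)[OF N(1)] r_def\<close>)
  then show "q = p" using r by simp
qed (use p in simp)

section \<open>Derivative and sub-level sets of the distance function\<close>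

lemma norm_dist_has_derivative:
  fixes N :: "'a::euclidean_space \<Rightarrow> real"
  assumes N: "is_norm N" "smooth_norm N" and K: "compact K" "convex K" and x: "x \<notin> K"
    and p: "p \<in> K" "N (x - p) = norm_dist N K x" and a: "norming N a (x - p)"
  shows "(norm_dist N K has_derivative (\<bullet>) a) (at x)"
proof (rule convex_has_derivative_touching)
  show "convex_on UNIV (norm_dist N K)" using N K p by (intro norm_dist_convex_on) auto
  show "norm_dist N K y \<le> N (y - p)" for y by (rule norm_dist_le[OF N(1) p(1)])
  show "norm_dist N K x = N (x - p)" using p by simp
  have "x - p \<noteq> 0" using x p by auto
  then have "(N has_derivative (\<bullet>) a) (at (x - p))" by (rule norm_has_derivative_norming[OF N _ a])
  then show "((\<lambda>y. N (y - p)) has_derivative (\<bullet>) a) (at x)"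
    by (rule has_derivative_compose[rotated, where g = N, simplified])
       (auto intro!: derivative_eq_intros)
qed

text \<open>A supporting hyperplane of the sub-level set at \<open>x\<close> also supports the ball
  of radius \<open>r\<close> around \<open>p\<close>; translating and scaling moves the contact
  point to \<open>u\<close> on the unit ball, where smoothness applies. Conversely, the gradient
  inequality for the distance puts the sub-level set on one side of the kernel of
  \<open>a\<close>.\<close>

lemma norm_dist_sublevel_support:
  fixes N :: "'a::euclidean_space \<Rightarrow> real"
  assumes N: "is_norm N" "smooth_norm N" and K: "compact K" "convex K" and x: "x \<notin> K"
    and p: "p \<in> K" "N (x - p) = norm_dist N K x" and a: "norming N a (x - p)"
  shows "supports_at h {y. norm_dist N K y \<le> norm_dist N K x} x \<longleftrightarrow> h = {z. a \<bullet> z = 0}"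
proof
  let ?f = "norm_dist N K"
  let ?L = "{y. ?f y \<le> ?f x}"
  define r where "r = ?f x"
  define u where "u = (1 / r) *\<^sub>R (x - p)"
  have xp: "x - p \<noteq> 0" using x p by auto
  have r: "r > 0" using p is_norm_pos[OF N(1) xp] by (simp add: r_def)
  have xu: "x = p + r *\<^sub>R u" using r by (simp add: u_def)
  have au: "a \<bullet> u = 1" using a p r by (simp add: norming_def u_def r_def)
  have u: "u = (1 / N (x - p)) *\<^sub>R (x - p)" using p by (simp add: u_def r_def)
  {
    assume "supports_at h ?L x"
    then obtain b where b: "b \<noteq> 0" "h = {z. b \<bullet> z = 0}"
      and side: "?L \<subseteq> {z. b \<bullet> z \<le> b \<bullet> x} \<or> ?L \<subseteq> {z. b \<bullet> z \<ge> b \<bullet> x}"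
      by (auto simp: supports_at_def)
    have "p + r *\<^sub>R z \<in> ?L" if "z \<in> unit_ball N" for z
    proof -
      have "?f (p + r *\<^sub>R z) \<le> r * N z"
        using norm_dist_le[OF N(1) p(1), of "p + r *\<^sub>R z"] r by (simp add: is_normD(3)[OF N(1)])
      also have "\<dots> \<le> r" using that r by (simp add: unit_ball_def)
      finally show ?thesis by (simp add: r_def)
    qed
    then have "(\<forall>z\<in>unit_ball N. b \<bullet> (p + r *\<^sub>R z) \<le> b \<bullet> x) \<or> (\<forall>z\<in>unit_ball N. b \<bullet> (p + r *\<^sub>R z) \<ge> b \<bullet> x)"
      using side by blast
    then have "unit_ball N \<subseteq> {z. b \<bullet> z \<le> b \<bullet> u} \<or> unit_ball N \<subseteq> {z. b \<bullet> z \<ge> b \<bullet> u}"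
      using r by (subst (asm) (1 2) xu) (auto simp: inner_add_right)
    moreover have "u \<in> frontier (unit_ball N)"
      using r p by (intro norm_eq_1_in_frontier[OF N(1)]) (simp add: is_normD(3)[OF N(1)] u_def r_def)
    ultimately have "supports_at h (unit_ball N) u" using b by (auto simp: supports_at_def)
    then show "h = {z. a \<bullet> z = 0}"
      using smooth_norm_unique_support[OF N xp a] u by simp
  }
  {
    assume h: "h = {z. a \<bullet> z = 0}"
    have conv: "convex_on UNIV ?f" using N K p by (intro norm_dist_convex_on) auto
    have above: "?f x + a \<bullet> (y - x) \<le> ?f y" for y
      by (rule convex_above_derivative[OF conv norm_dist_has_derivative[OF N K x p a]])
    \<comment> \<open>Since \<open>a \<bullet> u = 1\<close>, moving from \<open>x\<close> in
      direction \<open>u\<close> strictly increases the distance, by the gradient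
      inequality.\<close>
    have "x \<notin> interior ?L"
    proof
      assume "x \<in> interior ?L"
      then obtain e where e: "e > 0" "cball x e \<subseteq> ?L" by (auto simp: mem_interior_cball)
      have "u \<noteq> 0" using au by auto
      then have "x + (e / norm u) *\<^sub>R u \<in> ?L" using e by (intro subsetD[OF e(2)]) (simp add: dist_norm)
      moreover have "a \<bullet> ((e / norm u) *\<^sub>R u) > 0" using au e \<open>u \<noteq> 0\<close> by simp
      ultimately show False using above[of "x + (e / norm u) *\<^sub>R u"] by simp
    qed
    moreover have "x \<in> closure ?L" using closure_subset[of ?L] by auto
    moreover have "a \<noteq> 0" using au by auto
    moreover have "?L \<subseteq> {z. a \<bullet> z \<le> a \<bullet> x}"
    proof
      fix z assume "z \<in> ?L"
      then show "z \<in> {z. a \<bullet> z \<le> a \<bullet> x}" using above[of z] by (simp add: inner_diff_right)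
    qed
    ultimately show "supports_at h ?L x" using h by (auto simp: supports_at_def frontier_def)
  }
qed

section \<open>Identification of the norm gradient\<close>

lemma birkhoff_orth_norming_kernel_iff:
  fixes N :: "'a::euclidean_space \<Rightarrow> real"
  assumes N: "is_norm N" "strictly_convex_norm N" and u: "N u = 1" and a: "norming N a u"
  shows "w \<noteq> 0 \<and> birkhoff_left_orth N w {z. a \<bullet> z = 0} \<and> a \<bullet> w = (N w)\<^sup>2 \<longleftrightarrow> w = u"
proof
  have au: "a \<bullet> u = 1" and le: "\<And>z. a \<bullet> z \<le> N z" using a u by (auto simp: norming_def)
  {
    assume w: "w \<noteq> 0 \<and> birkhoff_left_orth N w {z. a \<bullet> z = 0} \<and> a \<bullet> w = (N w)\<^sup>2"
    have Nw: "N w > 0" using w is_norm_pos[OF N(1)] by blast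
    \<comment> \<open>This kernel vector carries \<open>w\<close> to the multiple
      \<open>(a \<bullet> w) *\<^sub>R u\<close>, of norm \<open>(N w)\<^sup>2\<close>.
      Orthogonality thus gives \<open>N w \<ge> 1\<close>, and the bound on \<open>a\<close> gives
      the reverse.\<close>
    define z where "z = (a \<bullet> w) *\<^sub>R u - w"
    have "a \<bullet> z = 0" by (simp add: z_def inner_diff_right au)
    then have "N w \<le> N (w + 1 *\<^sub>R z)"
      using w unfolding birkhoff_left_orth_def birkhoff_orth_def by blast
    also have "\<dots> = (N w)\<^sup>2" using w u by (simp add: z_def is_normD(3)[OF N(1)])
    finally have "N w \<ge> 1" using Nw by (simp add: power2_eq_square)
    moreover have "(N w)\<^sup>2 \<le> N w" using le[of w] w by simp
    then have "N w \<le> 1" using Nw by (simp add: power2_eq_square)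
    ultimately have w1: "N w = 1" by simp
    \<comment> \<open>Now \<open>a\<close> equals 1 at both \<open>w\<close> and \<open>u\<close>,
      hence on the whole segment, which therefore avoids the open unit ball.\<close>
    show "w = u"
    proof (rule strictly_convex_norm_eq[OF N w1 u])
      fix s :: real
      show "1 \<le> N ((1 - s) *\<^sub>R w + s *\<^sub>R u)"
        using le[of "(1 - s) *\<^sub>R w + s *\<^sub>R u"] w w1 au by (simp add: inner_add_right)
    qed
  }
  {
    assume w: "w = u"
    have "N u \<le> N (u + t *\<^sub>R z)" if "a \<bullet> z = 0" for z t
      using le[of "u + t *\<^sub>R z"] that u au by (simp add: inner_add_right)
    then show "w \<noteq> 0 \<and> birkhoff_left_orth N w {z. a \<bullet> z = 0} \<and> a \<bullet> w = (N w)\<^sup>2"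
      using w u au by (auto simp: birkhoff_left_orth_def birkhoff_orth_def)
  }
qed

lemma norm_dist_has_norm_gradient:
  fixes N :: "'a::euclidean_space \<Rightarrow> real"
  assumes N: "is_norm N" "smooth_norm N" "strictly_convex_norm N"
    and K: "compact K" "convex K" "K \<noteq> {}" and x: "x \<notin> K"
  shows "has_norm_gradient N (norm_dist N K) x (unit_outward N K x)"
proof -
  let ?f = "norm_dist N K"
  obtain p where p: "p \<in> K" "N (x - p) = ?f x" by (rule norm_dist_attained[OF N(1) K(1,3)])
  obtain a where a: "norming N a (x - p)" using norming_exists[OF N(1)] by blast
  define u where "u = (1 / N (x - p)) *\<^sub>R (x - p)"
  have r: "N (x - p) > 0" using x p by (intro is_norm_pos[OF N(1)]) auto
  have out: "unit_outward N K x = u"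
    using metric_projection_eq[OF N(1,3) K(2) x p] by (simp add: unit_outward_def u_def)
  have Nu: "N u = 1" using r by (simp add: u_def is_normD(3)[OF N(1)])
  have au: "norming N a u" using a r Nu by (simp add: norming_def u_def)
  \<comment> \<open>The point \<open>p\<close> has smaller distance than \<open>x\<close>, so
    \<open>x\<close> is no minimiser and the non-zero case of the gradient definition
    applies.\<close>
  have "?f p \<le> 0" using norm_dist_le[OF N(1) p(1), of p] is_normD(2)[OF N(1), of 0] by simp
  then have nmin: "\<not> (\<forall>y. ?f x \<le> ?f y)" using r p by (metis not_le order_le_less_trans)
  have "gradient_conditions N ?f x ((\<bullet>) a) w \<longleftrightarrow>
      birkhoff_left_orth N w {z. a \<bullet> z = 0} \<and> a \<bullet> w = (N w)\<^sup>2" for w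
    unfolding gradient_conditions_def norm_dist_sublevel_support[OF N(1,2) K(1,2) x p a] by metis
  then have "w \<noteq> 0 \<and> gradient_conditions N ?f x ((\<bullet>) a) w \<longleftrightarrow> w = u" for w
    using birkhoff_orth_norming_kernel_iff[OF N(1,3) Nu au, of w] by simp
  then show ?thesis
    unfolding has_norm_gradient_def out
    using norm_dist_convex_on[OF N(1) K] norm_dist_has_derivative[OF N(1,2) K(1,2) x p a] nmin
    by auto
qed

theorem theorem5p1:
  fixes N :: "real ^ 'n \<Rightarrow> real" and K :: "(real ^ 'n) set"
  assumes "is_norm N" and "smooth_norm N" and "strictly_convex_norm N"
    and "convex_body K"
  shows "(\<forall>x. x \<notin> K \<longrightarrow> norm_dist N K differentiable (at x)) \<and>
         (\<forall>x. x \<notin> K \<longrightarrow>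
            has_norm_gradient N (norm_dist N K) x (unit_outward N K x) \<and>
            norm_gradient N (norm_dist N K) x = unit_outward N K x)"
proof -
  have K: "compact K" "convex K" "K \<noteq> {}" using assms(4) by (auto simp: convex_body_def)
  have "has_norm_gradient N (norm_dist N K) x (unit_outward N K x)" if "x \<notin> K" for x
    by (rule norm_dist_has_norm_gradient[OF assms(1-3) K that])
  then show ?thesis
    using norm_gradient_eq unfolding has_norm_gradient_def differentiable_def by blast
qed

end
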